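(* For every integer $m\ge1$, the number $n_m$ satisfies $\rho(n_m)\ge\rho(n)$ for all $n\in S_m$; that is, $n_m$ is an LR number.
   Context: For an integer $n\ge 2$, $\sigma(n)$ is the sum of the positive divisors of $n$ and $\rho(n):=\sigma(n)/n$. For $n=\prod_{i} p_i^{a_i}$, let $\omega(n):=\sum_i a_i$ (sum of the exponents in the prime factorization). For $m\ge1$ let $S_m:=\{n\in\mathbb{N}: n\ge 2,\ \omega(n)=m\}$. An element $n\in S_m$ with $\rho(n)\ge\rho(n')$ for all $n'\in S_m$ is called an LR (largest rho-value) number. Consider all pairs $(q,k)$ with $q$ prime and $k\ge 1$ an integer, with value $z_{q,k}:=q+q^2+\cdots+q^k$. Enumerate these pairs as $(q_1,k_1),(q_2,k_2),\dots$ so that $z_i:=z_{q_i,k_i}$ is nondecreasing in $i$; if $z_{q,k}=z_{p,j}$ with $q>p$, then $(q,k)$ comes before $(p,j)$. For $m\ge1$ let $E_m$ be the set of the first $m$ pairs; for each prime $p$ let $k_p$ be the largest $k$ with $(p,k)\in E_m$ ($k_p=0$ if none), and define $n_m:=\prod_p p^{k_p}$. *)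

theory Defs
  imports Complex_Main "HOL-Computational_Algebra.Primes" "HOL-Library.Infinite_Set"
begin

definition sigma :: "nat \<Rightarrow> nat" where
  "sigma n = (\<Sum>d | d dvd n. d)"

definition rho :: "nat \<Rightarrow> real" where
  "rho n = real (sigma n) / real n"

text \<open>Prime factors are counted with multiplicity.\<close>

definition omega :: "nat \<Rightarrow> nat" where
  "omega n = (\<Sum>p\<in>prime_factors n. multiplicity p n)"

definition S :: "nat \<Rightarrow> nat set" where
  "S m = {n. n \<ge> 2 \<and> omega n = m}"

definition is_LR :: "nat \<Rightarrow> nat \<Rightarrow> bool" where
  "is_LR m n \<longleftrightarrow> n \<in> S m \<and> (\<forall>n'\<in>S m. rho n \<ge> rho n')"

definition prime_pairs :: "(nat \<times> nat) set" where
  "prime_pairs = {(q, k). prime q \<and> k \<ge> 1}"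

definition zval :: "nat \<times> nat \<Rightarrow> nat" where
  "zval = (\<lambda>(q, k). \<Sum>j=1..k. q ^ j)"

text \<open>
  Enumerations are indexed from 1; the value at 0 is irrelevant. Every pair is listed exactly once,
  and among pairs with the same value the one with the larger prime comes first.
\<close>

definition pair_enumeration :: "(nat \<Rightarrow> nat \<times> nat) \<Rightarrow> bool" where
  "pair_enumeration e \<longleftrightarrow>
     bij_betw e {1..} prime_pairs \<and>
     (\<forall>i\<ge>1. \<forall>j\<ge>i. zval (e i) \<le> zval (e j)) \<and>
     (\<forall>i\<ge>1. \<forall>j\<ge>1. zval (e i) = zval (e j) \<and> fst (e i) > fst (e j) \<longrightarrow> i < j)"

definition first_pairs :: "(nat \<Rightarrow> nat \<times> nat) \<Rightarrow> nat \<Rightarrow> (nat \<times> nat) set" where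
  "first_pairs e m = e ` {1..m}"

definition max_exponent :: "(nat \<Rightarrow> nat \<times> nat) \<Rightarrow> nat \<Rightarrow> nat \<Rightarrow> nat" where
  "max_exponent e m p =
     (if \<exists>k. (p, k) \<in> first_pairs e m then Max {k. (p, k) \<in> first_pairs e m} else 0)"

text \<open>The product is restricted to the finitely many primes with a nonzero exponent.\<close>

definition n_of :: "(nat \<Rightarrow> nat \<times> nat) \<Rightarrow> nat \<Rightarrow> nat" where
  "n_of e m = (\<Prod>p | prime p \<and> max_exponent e m p \<noteq> 0. p ^ max_exponent e m p)"

text \<open>
  An enumeration exists, so that hypotheses of the form \<^term>\<open>pair_enumeration e\<close> are not vacuous.
  The numbers \<^term>\<open>zval x ^ 2 + (zval x - fst x)\<close> order the pairs in the required way.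
\<close>

lemma fst_le_zval: "fst x \<le> zval x" if x_in: "x \<in> prime_pairs"
proof -
  obtain q k where x: "x = (q, k)" "k \<ge> 1" using x_in by (cases x) (auto simp: prime_pairs_def)
  have "(\<Sum>j\<in>{1}. q ^ j) \<le> (\<Sum>j=1..k. q ^ j)"
    using x(2) by (intro sum_mono2) auto
  then show ?thesis by (simp add: x zval_def)
qed

lemma zval_inj: "k = l" if "zval (q, k) = zval (q, l)" "prime q"
proof -
  have less: "zval (q, a) < zval (q, b)" if "a < b" for a b
    unfolding zval_def prod.case
    using that prime_gt_0_nat[OF \<open>prime q\<close>] by (intro sum_strict_mono2[where b = b]) auto
  show ?thesis using less[of k l] less[of l k] that(1) by (cases k l rule: linorder_cases) auto
qed

lemma key_less:
  fixes a b c d :: nat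
  assumes "a < b \<or> a = b \<and> d < c" "0 < c" "c \<le> a" "0 < d" "d \<le> b"
  shows "a ^ 2 + (a - c) < b ^ 2 + (b - d)"
proof (cases "a < b")
  case True
  then have "(a + 1) ^ 2 \<le> b ^ 2" by (intro power_mono) auto
  then have "a ^ 2 + 2 * a + 1 \<le> b ^ 2" by (simp add: power2_eq_square algebra_simps)
  then show ?thesis by linarith
qed (use assms in auto)

lemma ex_pair_enumeration: "\<exists>e. pair_enumeration e"
proof -
  define f where "f x = zval x ^ 2 + (zval x - fst x)" for x :: "nat \<times> nat"
  have less: "f x < f y" if "x \<in> prime_pairs" "y \<in> prime_pairs"
    and "zval x < zval y \<or> zval x = zval y \<and> fst y < fst x" for x y
    unfolding f_def using that fst_le_zval[of x] fst_le_zval[of y]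
    by (intro key_less) (auto simp: prime_pairs_def prime_gt_0_nat)
  have inj: "inj_on f prime_pairs"
  proof (rule inj_onI)
    fix x y assume xy: "x \<in> prime_pairs" "y \<in> prime_pairs" "f x = f y"
    then have "zval x = zval y" "fst x = fst y"
      using less[of x y] less[of y x] by (metis less_irrefl linorder_neqE_nat)+
    then show "x = y" using xy zval_inj by (cases x; cases y) (auto simp: prime_pairs_def)
  qed
  have "(\<lambda>q. (q, 1)) ` {p :: nat. prime p} \<subseteq> prime_pairs" by (auto simp: prime_pairs_def)
  moreover have "infinite ((\<lambda>q. (q, 1 :: nat)) ` {p :: nat. prime p})"
    using primes_infinite finite_imageD by (fastforce simp: inj_on_def)
  ultimately have "infinite prime_pairs" by (rule infinite_super)
  then have inf: "infinite (f ` prime_pairs)" using inj finite_imageD by blast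
  define g where "g i = enumerate (f ` prime_pairs) (i - 1)" for i
  define e where "e i = inv_into prime_pairs f (g i)" for i
  have g_mem: "g i \<in> f ` prime_pairs" for i unfolding g_def by (rule enumerate_in_set[OF inf])
  have e_mem: "e i \<in> prime_pairs" for i unfolding e_def by (rule inv_into_into[OF g_mem])
  have f_e: "f (e i) = g i" for i unfolding e_def by (rule f_inv_into_f[OF g_mem])
  have g_mono: "g i < g j" if "1 \<le> i" "i < j" for i j
    unfolding g_def using that by (intro enumerate_mono inf) auto
  have "bij_betw e {1..} prime_pairs"
  proof (rule bij_betw_imageI)
    show "inj_on e {1..}"
      by (rule inj_onI) (metis atLeast_iff f_e g_mono less_irrefl linorder_neqE_nat)
    show "e ` {1..} = prime_pairs"
    proof (intro equalityI subsetI)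
      fix x assume x: "x \<in> prime_pairs"
      then obtain i where "enumerate (f ` prime_pairs) i = f x"
        using enumerate_Ex[OF inf, of "f x"] by blast
      then have "g (Suc i) = f x" by (simp add: g_def)
      then have "e (Suc i) = x" unfolding e_def using inj x by simp
      then show "x \<in> e ` {1..}" by force
    qed (use e_mem in auto)
  qed
  moreover have "zval (e i) \<le> zval (e j)" if "1 \<le> i" "i \<le> j" for i j
    using that less[of "e j" "e i"] e_mem f_e g_mono[of i j]
    by (metis le_neq_implies_less less_asym linorder_le_less_linear order_refl)
  moreover have "i < j" if "1 \<le> i" "1 \<le> j" "zval (e i) = zval (e j)" "fst (e j) < fst (e i)" for i j
    using that less[of "e i" "e j"] e_mem f_e g_mono[of j i]
    by (metis less_asym linorder_neqE_nat less_irrefl)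
  ultimately show ?thesis unfolding pair_enumeration_def by blast
qed

end

theory Submission
  imports Defs
begin

text \<open>
  Since \<open>\<sigma>(p\<^sup>j) = 1 + z\<^bsub>p,j\<^esub>\<close> and \<open>p \<sigma>(p\<^bsup>j-1\<^esup>) = z\<^bsub>p,j\<^esub>\<close>, raising the exponent of \<open>p\<close> from \<open>j - 1\<close>
  to \<open>j\<close> multiplies \<open>\<rho>\<close> by \<open>1 + 1 / z\<^bsub>p,j\<^esub>\<close>. Hence \<open>\<rho>(n)\<close> is the product of these factors over the
  \<open>\<omega>(n)\<close> pairs \<open>(p, j)\<close> with \<open>1 \<le> j \<le> v\<^sub>p(n)\<close>. Among all sets of \<open>m\<close> pairs the product is largest for
  the \<open>m\<close> pairs with the smallest \<open>z\<close>, and these are the pairs of a number because \<open>z\<^bsub>p,j\<^esub>\<close> is strictly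
  increasing in \<open>j\<close>.
\<close>

section \<open>Multiplicativity of \<open>rho\<close> and its values at prime powers\<close>

lemma sigma_mult_coprime:
  assumes "coprime a b"
  shows "sigma (a * b) = sigma a * sigma b"
proof -
  have inj: "inj_on (\<lambda>(x, y). x * y) ({d. d dvd a} \<times> {d. d dvd b})"
  proof (intro inj_onI; clarify)
    fix x y x' y'
    assume dvds: "x dvd a" "y dvd b" "x' dvd a" "y' dvd b" and eq: "x * y = x' * y'"
    \<comment> \<open>Divisors of \<open>a\<close> are coprime to divisors of \<open>b\<close>, so
      cross-comparing \<open>x * y = x' * y'\<close> separates the two factors.\<close>
    have "coprime x y'" "coprime x' y" "coprime y x'" "coprime y' x"
      using dvds assms by (meson coprime_divisors coprime_commute)+
    then show "x = x' \<and> y = y'"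
      using eq by (metis coprime_crossproduct_nat mult.commute)
  qed
  have "{d. d dvd a * b} = (\<lambda>(x, y). x * y) ` ({d. d dvd a} \<times> {d. d dvd b})"
    by (auto simp: mult_dvd_mono elim: dvd_productE)
  then have "sigma (a * b) = (\<Sum>(x, y) \<in> {d. d dvd a} \<times> {d. d dvd b}. x * y)"
    unfolding sigma_def using sum.reindex[OF inj, of "\<lambda>d. d"] by (simp add: comp_def)
  also have "\<dots> = sigma a * sigma b"
    unfolding sigma_def by (simp add: sum_product sum.cartesian_product)
  finally show ?thesis .
qed

lemma rho_mult_coprime: "coprime a b \<Longrightarrow> rho (a * b) = rho a * rho b"
  by (simp add: rho_def sigma_mult_coprime)

lemma rho_1: "rho 1 = 1"
  by (simp add: rho_def sigma_def)

lemma sigma_prime_power: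
  assumes "prime p"
  shows "sigma (p ^ k) = (\<Sum>j\<le>k. p ^ j)"
proof -
  have "{d. d dvd p ^ k} = (\<lambda>j. p ^ j) ` {..k}"
    using assms by (auto simp: divides_primepow_nat)
  moreover have "inj_on (\<lambda>j. p ^ j) {..k}"
    using prime_gt_1_nat[OF assms] by (auto simp: inj_on_def)
  ultimately show ?thesis
    by (simp add: sigma_def sum.reindex)
qed

lemma zval_pos: "x \<in> prime_pairs \<Longrightarrow> 0 < zval x"
  using fst_le_zval[of x] by (auto simp: prime_pairs_def dest: prime_gt_0_nat)

lemma rho_prime_power:
  assumes "prime p"
  shows "rho (p ^ k) = (\<Prod>j=1..k. 1 + 1 / real (zval (p, j)))"
proof (induction k)
  case 0
  then show ?case using rho_1 by simp
next
  case (Suc k)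
  have z: "zval (p, Suc k) = p * sigma (p ^ k)"
    unfolding zval_def prod.case sigma_prime_power[OF assms] sum_distrib_left
    using sum.shift_bounds_cl_Suc_ivl[of "\<lambda>j. p ^ j" 0 k]
    by (simp add: atLeast0AtMost del: sum.cl_ivl_Suc)
  have s: "sigma (p ^ Suc k) = 1 + zval (p, Suc k)"
    unfolding zval_def prod.case sigma_prime_power[OF assms]
    using sum.atLeast_Suc_atMost[of 0 "Suc k" "\<lambda>j. p ^ j"]
    by (simp add: atLeast0AtMost del: sum.cl_ivl_Suc sum.atMost_Suc)
  have "0 < zval (p, Suc k)"
    using assms by (intro zval_pos) (simp add: prime_pairs_def)
  then have "rho (p ^ Suc k) = rho (p ^ k) * (1 + 1 / real (zval (p, Suc k)))"
    unfolding rho_def s using z prime_gt_0_nat[OF assms] by (simp add: field_simps)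
  then show ?case using Suc by simp
qed

lemma rho_prod_prime_powers:
  assumes "finite P" "\<And>p. p \<in> P \<Longrightarrow> prime p"
  shows "rho (\<Prod>p\<in>P. p ^ f p) = (\<Prod>p\<in>P. rho (p ^ f p))"
  using assms
proof (induction P rule: finite_induct)
  case empty
  then show ?case using rho_1 by simp
next
  case (insert q P)
  have "coprime (q ^ f q) (\<Prod>p\<in>P. p ^ f p)"
    using insert by (intro prod_coprime_right coprime_power_left_iff[THEN iffD2] disjI1)
      (auto intro!: primes_coprime simp del: coprime_power_left_iff)
  then show ?case
    using insert by (simp add: rho_mult_coprime)
qed

text \<open>Encoding \<open>n\<close> as a set of pairs turns \<open>omega\<close> into a
  cardinality and \<open>rho\<close> into a product over the set, so numbers with equal
  \<open>omega\<close> are compared as sets of equal size.\<close>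

definition exponent_pairs :: "nat \<Rightarrow> (nat \<times> nat) set" where
  "exponent_pairs n = (SIGMA p:prime_factors n. {1..multiplicity p n})"

lemma exponent_pairs_subset: "exponent_pairs n \<subseteq> prime_pairs"
  by (auto simp: exponent_pairs_def prime_pairs_def)

lemma finite_exponent_pairs: "finite (exponent_pairs n)"
  by (simp add: exponent_pairs_def)

lemma card_exponent_pairs: "card (exponent_pairs n) = omega n"
  by (simp add: exponent_pairs_def omega_def)

lemma mem_exponent_pairs_iff:
  "(p, k) \<in> exponent_pairs n \<longleftrightarrow> prime p \<and> 1 \<le> k \<and> k \<le> multiplicity p n"
  by (auto simp: exponent_pairs_def prime_factors_multiplicity)

lemma rho_eq_prod_exponent_pairs:
  assumes "0 < n"
  shows "rho n = (\<Prod>x\<in>exponent_pairs n. 1 + 1 / real (zval x))"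
proof -
  have "rho n = rho (\<Prod>p\<in>prime_factors n. p ^ multiplicity p n)"
    using prime_factorization_nat[OF assms] by simp
  also have "\<dots> = (\<Prod>p\<in>prime_factors n. \<Prod>j=1..multiplicity p n. 1 + 1 / real (zval (p, j)))"
    by (subst rho_prod_prime_powers)
      (auto intro!: prod.cong simp: rho_prime_power in_prime_factors_imp_prime)
  also have "\<dots> = (\<Prod>x\<in>exponent_pairs n. 1 + 1 / real (zval x))"
    unfolding exponent_pairs_def by (subst prod.Sigma) (auto intro!: prod.cong)
  finally show ?thesis .
qed

text \<open>The common part \<open>A \<inter> B\<close> contributes equally to both products. Equal
  cardinalities give a bijection from \<open>B - A\<close> to \<open>A - B\<close>; any one will do,
  since \<open>le\<close> compares every element of one difference with every element of the
  other.\<close>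

lemma prod_exchange_le:
  fixes f :: "'a \<Rightarrow> 'b::linordered_idom"
  assumes fin: "finite A" "finite B" and card: "card B = card A"
    and nonneg: "\<And>x. x \<in> A \<union> B \<Longrightarrow> 0 \<le> f x"
    and le: "\<And>a b. a \<in> A - B \<Longrightarrow> b \<in> B - A \<Longrightarrow> f b \<le> f a"
  shows "prod f B \<le> prod f A"
proof -
  have "card (B - A) = card (A - B)"
    using fin card by (simp add: card_Diff_subset_Int Int_commute)
  then obtain h where h: "bij_betw h (B - A) (A - B)"
    using fin finite_same_card_bij[of "B - A" "A - B"] by auto
  have "prod f (B - A) \<le> (\<Prod>x\<in>B - A. f (h x))"
    using nonneg le bij_betwE[OF h] by (intro prod_mono) blast
  also have "\<dots> = prod f (A - B)"
    by (rule prod.reindex_bij_betw[OF h])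
  finally have "prod f (A \<inter> B) * prod f (B - A) \<le> prod f (A \<inter> B) * prod f (A - B)"
    using nonneg by (intro mult_left_mono prod_nonneg) auto
  then show ?thesis
    using prod.Int_Diff[OF fin(1), of f B] prod.Int_Diff[OF fin(2), of f A]
    by (simp add: Int_commute)
qed

section \<open>The first m pairs as the exponent pairs of \<open>n_of e m\<close>\<close>

context
  fixes e :: "nat \<Rightarrow> nat \<times> nat" and m :: nat
  assumes enum: "pair_enumeration e"
begin

lemma first_pairs_subset: "first_pairs e m \<subseteq> prime_pairs"
  using enum by (auto simp: first_pairs_def pair_enumeration_def bij_betw_def)

lemma finite_first_pairs: "finite (first_pairs e m)"
  by (simp add: first_pairs_def)

lemma card_first_pairs: "card (first_pairs e m) = m"
proof -
  have "inj_on e {1..m}"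
    using enum by (auto simp: pair_enumeration_def bij_betw_def intro: inj_on_subset)
  then show ?thesis by (simp add: first_pairs_def card_image)
qed

lemma zval_le_outside_first_pairs:
  assumes "x \<in> first_pairs e m" "y \<in> prime_pairs - first_pairs e m"
  shows "zval x \<le> zval y"
proof -
  obtain i where i: "x = e i" "1 \<le> i" "i \<le> m"
    using assms by (auto simp: first_pairs_def)
  have "y \<in> e ` {1..}"
    using enum assms by (simp add: pair_enumeration_def bij_betw_def)
  then obtain j where j: "y = e j" "1 \<le> j"
    by auto
  \<comment> \<open>The indices 1 to m are used up by \<open>first_pairs e m\<close>, and indexing
    starts at 1.\<close>
  have "m < j"
    using j assms by (force simp: first_pairs_def)
  then show ?thesis
    using enum i j by (auto simp: pair_enumeration_def)
qed

text \<open>If \<open>(p, j)\<close> were left out, its value would be at least that of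
  \<open>(p, k)\<close>; as j \<le> k the two values would agree, and for a fixed prime equal values
  mean equal exponents.\<close>

lemma first_pairs_downward_closed:
  assumes "(p, k) \<in> first_pairs e m" "1 \<le> j" "j \<le> k"
  shows "(p, j) \<in> first_pairs e m"
proof (rule ccontr)
  assume notin: "(p, j) \<notin> first_pairs e m"
  have p: "prime p"
    using assms first_pairs_subset by (auto simp: prime_pairs_def)
  have "zval (p, k) \<le> zval (p, j)"
    using assms notin p by (intro zval_le_outside_first_pairs) (auto simp: prime_pairs_def)
  moreover have "zval (p, j) \<le> zval (p, k)"
    unfolding zval_def prod.case using assms by (intro sum_mono2) auto
  ultimately have "j = k"
    using zval_inj[of p k j] p by simp
  then show False using assms notin by simp
qed

lemma finite_exponents: "finite {k. (p, k) \<in> first_pairs e m}"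
  by (rule finite_subset[OF _ finite_imageI[OF finite_first_pairs, of snd]]) force

text \<open>Downward closure leaves no gaps below the maximum, so the maximal exponents determine
  the whole set of pairs.\<close>

lemma mem_first_pairs_iff:
  "(p, k) \<in> first_pairs e m \<longleftrightarrow> 1 \<le> k \<and> k \<le> max_exponent e m p"
proof
  assume pk: "(p, k) \<in> first_pairs e m"
  then have "1 \<le> k"
    using first_pairs_subset by (auto simp: prime_pairs_def)
  moreover have "k \<le> max_exponent e m p"
    using pk finite_exponents by (auto simp: max_exponent_def)
  ultimately show "1 \<le> k \<and> k \<le> max_exponent e m p" ..
next
  assume k: "1 \<le> k \<and> k \<le> max_exponent e m p"
  \<comment> \<open>A positive exponent rules out the default value 0, so the maximum is
    attained.\<close>
  then have ne: "\<exists>k. (p, k) \<in> first_pairs e m"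
    by (auto simp: max_exponent_def split: if_splits)
  then have "max_exponent e m p \<in> {k. (p, k) \<in> first_pairs e m}"
    using Max_in[OF finite_exponents] by (auto simp: max_exponent_def)
  then show "(p, k) \<in> first_pairs e m"
    using k first_pairs_downward_closed by auto
qed

lemma finite_support: "finite {p. prime p \<and> max_exponent e m p \<noteq> 0}"
proof (rule finite_subset)
  show "{p. prime p \<and> max_exponent e m p \<noteq> 0} \<subseteq> fst ` first_pairs e m"
  proof
    fix p assume "p \<in> {p. prime p \<and> max_exponent e m p \<noteq> 0}"
    then have "(p, 1) \<in> first_pairs e m"
      by (simp add: mem_first_pairs_iff)
    then show "p \<in> fst ` first_pairs e m"
      by (rule image_eqI[rotated]) simp
  qed
qed (rule finite_imageI[OF finite_first_pairs])

lemma multiplicity_n_of: "prime p \<Longrightarrow> multiplicity p (n_of e m) = max_exponent e m p"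
  unfolding n_of_def using finite_support by (subst multiplicity_prod_prime_powers) auto

text \<open>This carries facts about the first m pairs over to \<open>n_of e m\<close>: their number
  gives \<open>omega\<close>, and the product over them gives \<open>rho\<close>.\<close>

lemma exponent_pairs_n_of: "exponent_pairs (n_of e m) = first_pairs e m"
  using first_pairs_subset mem_first_pairs_iff multiplicity_n_of
  by (auto simp: mem_exponent_pairs_iff prime_pairs_def)

lemma omega_n_of: "omega (n_of e m) = m"
  by (simp add: card_exponent_pairs [symmetric] exponent_pairs_n_of card_first_pairs)

lemma n_of_pos: "0 < n_of e m"
  unfolding n_of_def by (auto intro!: prod_pos simp: prime_gt_0_nat)

lemma n_of_in_S:
  assumes "1 \<le> m"
  shows "n_of e m \<in> S m"
proof -
  \<comment> \<open>The number 1 has \<open>omega\<close> equal to 0, which m \<ge> 1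
    excludes.\<close>
  have "n_of e m \<noteq> 1"
    using omega_n_of assms by (auto simp: omega_def)
  then show ?thesis
    using n_of_pos omega_n_of by (simp add: S_def)
qed

lemma rho_le_rho_n_of:
  assumes "n \<in> S m"
  shows "rho n \<le> rho (n_of e m)"
proof -
  have n: "0 < n" "omega n = m"
    using assms by (auto simp: S_def)
  have "(\<Prod>x\<in>exponent_pairs n. 1 + 1 / real (zval x)) \<le> (\<Prod>x\<in>first_pairs e m. 1 + 1 / real (zval x))"
  proof (rule prod_exchange_le)
    show "card (exponent_pairs n) = card (first_pairs e m)"
      by (simp add: card_exponent_pairs card_first_pairs n)
    fix x y assume x: "x \<in> first_pairs e m - exponent_pairs n"
      and y: "y \<in> exponent_pairs n - first_pairs e m"
    then have "zval x \<le> zval y"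
      using zval_le_outside_first_pairs exponent_pairs_subset by blast
    \<comment> \<open>Positivity of the smaller value is what lets reciprocals reverse the
      inequality.\<close>
    moreover have "0 < zval x"
      using x first_pairs_subset zval_pos by blast
    ultimately show "1 + 1 / real (zval y) \<le> 1 + 1 / real (zval x)"
      by (simp add: frac_le)
  qed (auto simp: finite_exponent_pairs finite_first_pairs)
  then show ?thesis
    by (simp add: rho_eq_prod_exponent_pairs n n_of_pos exponent_pairs_n_of)
qed

end

theorem theorem1:
  fixes e :: "nat \<Rightarrow> nat \<times> nat" and m :: nat
  assumes "pair_enumeration e"
    and "m \<ge> 1"
  shows "(\<forall>n\<in>S m. rho (n_of e m) \<ge> rho n) \<and> is_LR m (n_of e m)"
  using rho_le_rho_n_of n_of_in_S assms by (simp add: is_LR_def)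

end
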